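(* Let $h$ be a function with polynomial growth belonging to a Hardy field, and let $W(x)=e^{\sqrt{x}}$. Suppose $\lim_{x\to\infty}\sqrt{x}\,|h'(x)-p(x)|=\infty$ for all $p\in\mathbb{Q}[x]$, and that there is $q\in\mathbb{Q}[x]$ with $\lim_{x\to\infty}|h'(x)-q(x)|<\infty$. Then \[ \lim_{N\to\infty}\mathbb{E}^W_{n\le N}e^{2\pi i k h(n)}=0\quad\text{for every }k\in\mathbb{Z}\setminus\{0\}. \]
   Context: Polynomial growth: there exist $c,d\ge1$ with $|h(x)|\le x^d$ for $x\ge c$. A Hardy field is a field of germs at $\infty$ of real-valued differentiable functions closed under differentiation. For $W\colon\mathbb{N}\to[0,\infty)$, $\Delta W(N)=W(N)-W(N-1)$ for $N\ge2$, $\Delta W(1)=W(1)$, and $\mathbb{E}^W_{n\le N}a_n=\frac{1}{W(N)}\sum_{n=1}^N\Delta W(n)a_n$. *)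

theory Defs
  imports "HOL-Analysis.Analysis" "HOL-Computational_Algebra.Polynomial"
begin

text \<open>
  Germs at infinity are equivalence classes of functions under eventual equality.
  A set of germs is represented here by the set of all representatives of its members, i.e.
  by a set of functions that is closed under eventual equality (\<open>germ_closed\<close>).
  Functions are total, but their values on bounded sets are irrelevant; in particular, a germ is
  differentiable if its representatives are differentiable on some half-line.
\<close>

locale hardy_field =
  fixes H :: "(real \<Rightarrow> real) set"
  assumes germ_closed: "f \<in> H \<Longrightarrow> eventually (\<lambda>x. f x = g x) at_top \<Longrightarrow> g \<in> H"
    and zero_closed: "(\<lambda>x. 0) \<in> H"
    and one_closed: "(\<lambda>x. 1) \<in> H"
    and add_closed: "f \<in> H \<Longrightarrow> g \<in> H \<Longrightarrow> (\<lambda>x. f x + g x) \<in> H"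
    and uminus_closed: "f \<in> H \<Longrightarrow> (\<lambda>x. - f x) \<in> H"
    and mult_closed: "f \<in> H \<Longrightarrow> g \<in> H \<Longrightarrow> (\<lambda>x. f x * g x) \<in> H"
    and inverse_closed: "f \<in> H \<Longrightarrow> \<not> eventually (\<lambda>x. f x = 0) at_top \<Longrightarrow>
      \<exists>g\<in>H. eventually (\<lambda>x. f x * g x = 1) at_top"
    and differentiable: "f \<in> H \<Longrightarrow> eventually (\<lambda>x. f differentiable (at x)) at_top"
    and deriv_closed: "f \<in> H \<Longrightarrow> deriv f \<in> H"

definition polynomial_growth :: "(real \<Rightarrow> real) \<Rightarrow> bool" where
  "polynomial_growth h \<longleftrightarrow> (\<exists>c\<ge>1. \<exists>d\<ge>1. \<forall>x\<ge>c. \<bar>h x\<bar> \<le> x powr d)"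

abbreviation rpoly :: "rat poly \<Rightarrow> real \<Rightarrow> real" where
  "rpoly p \<equiv> poly (map_poly of_rat p)"

text \<open>The natural numbers start at 1 here; the value of \<open>weight_diff W\<close> at 0 is never used.\<close>

definition weight_diff :: "(nat \<Rightarrow> real) \<Rightarrow> nat \<Rightarrow> real" where
  "weight_diff W n = (if n = 1 then W 1 else W n - W (n - 1))"

definition weighted_average :: "(nat \<Rightarrow> real) \<Rightarrow> nat \<Rightarrow> (nat \<Rightarrow> complex) \<Rightarrow> complex" where
  "weighted_average W N a =
     1 / of_real (W N) * (\<Sum>n=1..N. of_real (weight_diff W n) * a n)"

end

theory Submission
  imports Defs
begin

text \<open>
  The weights \<open>\<Delta>W\<close> of \<open>W(x) = exp (sqrt x)\<close> are increasing and of size \<open>W(N) / sqrt N\<close>, so by partial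
  summation it is enough that the unweighted sums of \<open>e(k h(n))\<close> are \<open>o(sqrt N)\<close>. Let \<open>Q\<close> be a
  rational primitive of \<open>q\<close> and \<open>g = h - Q\<close>. For a suitable \<open>M > 0\<close> the polynomial \<open>Q\<close> is
  \<open>M\<close>-periodic modulo 1 on the integers, hence \<open>e(k h(n + M)) = e(k h(n)) e(\<delta> n)\<close> with
  \<open>\<delta> n = k (g(n + M) - g(n))\<close>. The Hardy field makes \<open>g'\<close> eventually monotone with a finite limit;
  so \<open>\<delta>\<close> is eventually monotone and convergent, and the growth hypothesis, applied to \<open>q\<close> plus
  rational constants, keeps \<open>\<delta> n\<close> away from the integers by much more than \<open>1 / sqrt n\<close>. A
  Kusmin--Landau argument then bounds the sums.
\<close>

section \<open>Partial summation and a Kusmin-Landau estimate\<close>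

text \<open>Abel summation moves the differences from \<open>T\<close> to \<open>c\<close>, so it
  suffices to bound \<open>T\<close> and the total variation of \<open>c\<close>. It serves twice:
  for sliding sums against the reciprocals of \<open>cis - 1\<close>, and for partial sums against
  the weights.\<close>

lemma summation_by_parts_bound:
  fixes c T :: "nat \<Rightarrow> 'a::real_normed_field"
  assumes "a \<le> b" and T: "\<And>n. n \<in> {a..b} \<Longrightarrow> norm (T n) \<le> B"
  shows "norm (\<Sum>n=a..<b. c n * (T (Suc n) - T n)) \<le>
    B * (norm (c a) + norm (c b) + (\<Sum>n=a..<b. norm (c (Suc n) - c n)))"
proof -
  have eq: "(\<Sum>n=a..<b. c n * (T (Suc n) - T n)) =
      c b * T b - c a * T a - (\<Sum>n=a..<b. (c (Suc n) - c n) * T (Suc n))"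
    using \<open>a \<le> b\<close>
  proof (induction b rule: dec_induct)
    case base
    show ?case by simp
  next
    case (step m)
    then show ?case by (simp add: algebra_simps)
  qed
  have "norm (\<Sum>n=a..<b. (c (Suc n) - c n) * T (Suc n)) \<le> (\<Sum>n=a..<b. norm (c (Suc n) - c n) * B)"
    by (intro sum_norm_le) (auto simp: norm_mult intro!: mult_left_mono T)
  moreover have "norm (c b * T b) \<le> norm (c b) * B" "norm (c a * T a) \<le> norm (c a) * B"
    using \<open>a \<le> b\<close> by (auto simp: norm_mult intro!: mult_left_mono T)
  ultimately show ?thesis
    unfolding eq
    using norm_triangle_ineq4[of "c b * T b - c a * T a"
        "\<Sum>n=a..<b. (c (Suc n) - c n) * T (Suc n)"]
      norm_triangle_ineq4[of "c b * T b" "c a * T a"]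
    by (simp add: algebra_simps sum_distrib_left)
qed

lemma sum_abs_diff_monotone:
  fixes C :: "nat \<Rightarrow> real"
  assumes "a \<le> b"
    and "(\<forall>n\<ge>a. C n \<le> C (Suc n)) \<or> (\<forall>n\<ge>a. C (Suc n) \<le> C n)"
  shows "(\<Sum>n=a..<b. \<bar>C (Suc n) - C n\<bar>) = \<bar>C b - C a\<bar>"
  using assms(2)
proof
  assume *: "\<forall>n\<ge>a. C n \<le> C (Suc n)"
  then have "(\<Sum>n=a..<b. \<bar>C (Suc n) - C n\<bar>) = (\<Sum>n=a..<b. C (Suc n) - C n)"
    by (intro sum.cong) auto
  also have "\<dots> = C b - C a"
    using \<open>a \<le> b\<close> by (rule sum_Suc_diff')
  finally show ?thesis
    by (metis abs_of_nonneg sum_nonneg abs_ge_zero)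
next
  assume *: "\<forall>n\<ge>a. C (Suc n) \<le> C n"
  then have "(\<Sum>n=a..<b. \<bar>C (Suc n) - C n\<bar>) = (\<Sum>n=a..<b. - (C (Suc n) - C n))"
    by (intro sum.cong) auto
  also have "\<dots> = - (C b - C a)"
    using sum_Suc_diff'[OF \<open>a \<le> b\<close>, of C] by (simp only: sum_negf)
  finally show ?thesis
    by (metis abs_minus_cancel abs_of_nonneg sum_nonneg abs_ge_zero)
qed

text \<open>With \<open>s = pi * t\<close> one has
  \<open>cis (2 * s) - 1 = 2 * \<i> * sin s * cis s\<close>, whose reciprocal is
  \<open>cis (- s) / (2 * \<i> * sin s)\<close>. The constant real part matters: differences of such
  reciprocals are purely imaginary.\<close>

lemma inverse_cis_minus_one:
  assumes "sin (pi * t) \<noteq> 0"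
  shows "1 / (cis (2 * pi * t) - 1) = Complex (- 1 / 2) (- cot (pi * t) / 2)"
proof -
  define s where "s = pi * t"
  have 1: "cis (2 * pi * t) - 1 = Complex (- 2 * (sin s)\<^sup>2) (2 * sin s * cos s)"
    by (auto simp: complex_eq_iff s_def cos_double_sin sin_double mult.assoc)
  have s: "sin s \<noteq> 0" using assms by (simp add: s_def)
  have "(sin s)\<^sup>2 + cos s * cos s = 1"
    using sin_cos_squared_add3[of s] by (simp add: power2_eq_square add.commute)
  then have "Complex (- 1 / 2) (- cot s / 2) * (cis (2 * pi * t) - 1) = 1"
    unfolding 1 using s by (simp add: complex_eq_iff cot_def power2_eq_square)
  moreover from this have "cis (2 * pi * t) - 1 \<noteq> 0" by auto
  ultimately show ?thesis by (simp add: s_def divide_eq_eq)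
qed

text \<open>The difference \<open>cot x - cot y\<close> equals
  \<open>sin (y - x) / (sin x * sin y)\<close>, and no sine here is negative.\<close>

lemma cot_antimono:
  assumes "0 < x" "x \<le> y" "y < pi"
  shows "cot y \<le> cot x"
proof -
  have s: "sin x > 0" "sin y > 0" using assms by (auto intro!: sin_gt_zero)
  have "sin (y - x) \<ge> 0" using assms by (intro sin_ge_zero) auto
  then have "sin x * cos y \<le> cos x * sin y" by (simp add: sin_diff algebra_simps)
  then show ?thesis using s by (simp add: cot_def field_simps)
qed

text \<open>
  A form of the Kusmin--Landau inequality. Writing \<open>c n = 1 / (cis (2 * pi * \<delta> n) - 1)\<close>, the
  recurrence turns \<open>a n\<close> into \<open>c n\<close> times an increment of the sliding sums of \<open>M\<close>
  consecutive terms; \<open>c\<close> has constant real part and monotone imaginary part.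
\<close>

lemma sum_little_o_sqrt:
  fixes a :: "nat \<Rightarrow> complex" and \<delta> :: "nat \<Rightarrow> real"
  assumes a1: "\<And>n. norm (a n) \<le> 1"
    and rec: "eventually (\<lambda>n. a (n + M) = a n * cis (2 * pi * \<delta> n)) sequentially"
    and mono: "eventually (\<lambda>n. \<delta> n \<le> \<delta> (Suc n)) sequentially \<or>
               eventually (\<lambda>n. \<delta> (Suc n) \<le> \<delta> n) sequentially"
    and lim: "\<delta> \<longlonglongrightarrow> l"
    and large: "filterlim (\<lambda>n. sqrt (real n) * norm (cis (2 * pi * \<delta> n) - 1)) at_top sequentially"
  shows "(\<lambda>n. (\<Sum>i<n. a i) / of_real (sqrt (real n))) \<longlonglongrightarrow> 0"
proof -
  have ne1: "eventually (\<lambda>n. cis (2 * pi * \<delta> n) \<noteq> 1) sequentially"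
    using filterlim_at_top_dense[THEN iffD1, OF large, rule_format, of 0]
    by eventually_elim auto
  have notint: "\<delta> n \<notin> \<int>" if "cis (2 * pi * \<delta> n) \<noteq> 1" for n
    using that by (auto elim!: Ints_cases)
  \<comment> \<open>A monotone convergent \<open>\<delta>\<close> approaches \<open>l\<close> from
    one side and eventually avoids the integers, so it ends up strictly between two consecutive
    ones, even if \<open>l\<close> is an integer. The ceiling of \<open>l\<close> is the upper end
    in the increasing case, the floor of \<open>l\<close> the lower end in the decreasing
    case.\<close>
  have "\<exists>j::int. eventually (\<lambda>n. of_int j < \<delta> n \<and> \<delta> n < of_int (j + 1)) sequentially"
    using mono
  proof
    assume "eventually (\<lambda>n. \<delta> n \<le> \<delta> (Suc n)) sequentially"
    then obtain n0 where n0: "\<And>n. n \<ge> n0 \<Longrightarrow> \<delta> n \<le> \<delta> (Suc n)"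
      by (auto simp: eventually_sequentially)
    have ub: "\<delta> n \<le> l" if "n \<ge> n0" for n
    proof (rule LIMSEQ_le_const[OF lim])
      have "\<delta> n \<le> \<delta> m" if "n \<le> m" for m
        using that by (induction m rule: dec_induct) (use n0 \<open>n \<ge> n0\<close> in \<open>auto intro: order_trans\<close>)
      then show "\<exists>N. \<forall>m\<ge>N. \<delta> n \<le> \<delta> m" by blast
    qed
    have "of_int (\<lceil>l\<rceil> - 1) < l" by linarith
    from order_tendstoD(1)[OF lim this] ne1 eventually_ge_at_top[of n0]
    have "eventually (\<lambda>n. of_int (\<lceil>l\<rceil> - 1) < \<delta> n \<and> \<delta> n < of_int (\<lceil>l\<rceil> - 1 + 1)) sequentially"
    proof eventually_elim
      case (elim n)
      have "\<delta> n \<noteq> of_int \<lceil>l\<rceil>" using notint[OF elim(2)] by auto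
      moreover have "\<delta> n \<le> of_int \<lceil>l\<rceil>" using ub[OF elim(3)] by linarith
      ultimately show ?case using elim(1) by simp
    qed
    then show ?thesis by blast
  next
    assume "eventually (\<lambda>n. \<delta> (Suc n) \<le> \<delta> n) sequentially"
    then obtain n0 where n0: "\<And>n. n \<ge> n0 \<Longrightarrow> \<delta> (Suc n) \<le> \<delta> n"
      by (auto simp: eventually_sequentially)
    have lb: "l \<le> \<delta> n" if "n \<ge> n0" for n
    proof (rule LIMSEQ_le_const2[OF lim])
      have "\<delta> m \<le> \<delta> n" if "n \<le> m" for m
        using that by (induction m rule: dec_induct) (use n0 \<open>n \<ge> n0\<close> in \<open>auto intro: order_trans\<close>)
      then show "\<exists>N. \<forall>m\<ge>N. \<delta> m \<le> \<delta> n" by blast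
    qed
    have "l < of_int (\<lfloor>l\<rfloor> + 1)" by linarith
    from order_tendstoD(2)[OF lim this] ne1 eventually_ge_at_top[of n0]
    have "eventually (\<lambda>n. of_int \<lfloor>l\<rfloor> < \<delta> n \<and> \<delta> n < of_int (\<lfloor>l\<rfloor> + 1)) sequentially"
    proof eventually_elim
      case (elim n)
      have "\<delta> n \<noteq> of_int \<lfloor>l\<rfloor>" using notint[OF elim(2)] by auto
      moreover have "of_int \<lfloor>l\<rfloor> \<le> \<delta> n" using lb[OF elim(3)] by linarith
      ultimately show ?case using elim(1) by simp
    qed
    then show ?thesis by blast
  qed
  then obtain j :: int
    where j: "eventually (\<lambda>n. of_int j < \<delta> n \<and> \<delta> n < of_int (j + 1)) sequentially" by blast
  \<comment> \<open>Subtracting \<open>j\<close> leaves \<open>cis\<close> unchanged and puts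
    \<open>pi * t n\<close> into the single branch \<open>(0, pi)\<close> on which
    \<open>cot\<close> decreases.\<close>
  define t where "t n = \<delta> n - of_int j" for n
  define c where "c n = 1 / (cis (2 * pi * \<delta> n) - 1)" for n
  have cis_t: "cis (2 * pi * \<delta> n) = cis (2 * pi * t n)" for n
  proof -
    have "cis (2 * pi * \<delta> n) = cis (2 * pi * t n) * cis (2 * pi * of_int j)"
      unfolding cis_mult by (simp add: t_def algebra_simps)
    then show ?thesis by simp
  qed
  have c_cot: "c n = Complex (- 1 / 2) (- cot (pi * t n) / 2)" if "0 < t n" "t n < 1" for n
  proof -
    have "sin (pi * t n) > 0" using that by (intro sin_gt_zero) auto
    then show ?thesis unfolding c_def cis_t by (intro inverse_cis_minus_one) auto
  qed
  \<comment> \<open>The assumption \<open>large\<close> says exactly that \<open>c\<close> is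
    \<open>o(sqrt n)\<close>.\<close>
  have c_small: "eventually (\<lambda>n. norm (c n) \<le> e * sqrt (real n)) sequentially" if "e > 0" for e
    using filterlim_at_top[THEN iffD1, OF large, rule_format, of "1 / e"] ne1
  proof eventually_elim
    case (elim n)
    then show ?case using \<open>e > 0\<close> by (simp add: c_def norm_divide field_simps)
  qed
  show ?thesis
  proof (rule tendstoI)
    fix e :: real assume "e > 0"
    \<comment> \<open>In \<open>tail\<close> below, four terms of size at most
      \<open>e' * sqrt n\<close> (two endpoints, and a variation worth two more) are multiplied by
      the bound \<open>M\<close> on \<open>T\<close>, relaxed to \<open>M + 1\<close>. This gives
      \<open>(e / 2) * sqrt n\<close>; the \<open>+ 1\<close> keeps the denominator positive if
      \<open>M = 0\<close>.\<close>
    define e' where "e' = e / (8 * (real M + 1))"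
    have "e' > 0" using \<open>e > 0\<close> by (simp add: e'_def)
    from eventually_conj[OF c_small[OF this] eventually_conj[OF rec eventually_conj[OF j ne1]]]
    obtain n1 where n1: "\<And>n. n \<ge> n1 \<Longrightarrow> norm (c n) \<le> e' * sqrt (real n) \<and>
        a (n + M) = a n * cis (2 * pi * \<delta> n) \<and>
        (of_int j < \<delta> n \<and> \<delta> n < of_int (j + 1)) \<and> cis (2 * pi * \<delta> n) \<noteq> 1"
      by (auto simp: eventually_sequentially)
    have t01: "0 < t n \<and> t n < 1" if "n \<ge> n1" for n
      using n1[OF that] by (auto simp: t_def)
    have "\<exists>n0\<ge>n1. (\<forall>n\<ge>n0. Im (c n) \<le> Im (c (Suc n))) \<or> (\<forall>n\<ge>n0. Im (c (Suc n)) \<le> Im (c n))"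
      using mono
    proof
      assume "eventually (\<lambda>n. \<delta> n \<le> \<delta> (Suc n)) sequentially"
      then obtain n0 where n0: "\<And>n. n \<ge> n0 \<Longrightarrow> \<delta> n \<le> \<delta> (Suc n)"
        by (auto simp: eventually_sequentially)
      have "Im (c n) \<le> Im (c (Suc n))" if "n \<ge> max n0 n1" for n
        using t01[of n] t01[of "Suc n"] that n0[of n]
        by (simp add: c_cot) (intro cot_antimono, auto simp: t_def)
      then show ?thesis by (intro exI[of _ "max n0 n1"]) auto
    next
      assume "eventually (\<lambda>n. \<delta> (Suc n) \<le> \<delta> n) sequentially"
      then obtain n0 where n0: "\<And>n. n \<ge> n0 \<Longrightarrow> \<delta> (Suc n) \<le> \<delta> n"
        by (auto simp: eventually_sequentially)
      have "Im (c (Suc n)) \<le> Im (c n)" if "n \<ge> max n0 n1" for n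
        using t01[of n] t01[of "Suc n"] that n0[of n]
        by (simp add: c_cot) (intro cot_antimono, auto simp: t_def)
      then show ?thesis by (intro exI[of _ "max n0 n1"]) auto
    qed
    then obtain n0 where "n0 \<ge> n1" and
      n0: "(\<forall>n\<ge>n0. Im (c n) \<le> Im (c (Suc n))) \<or> (\<forall>n\<ge>n0. Im (c (Suc n)) \<le> Im (c n))" by blast
    define T where "T n = (\<Sum>m<M. a (n + m))" for n
    have T: "norm (T n) \<le> real M" for n
      unfolding T_def using sum_norm_le[of "{..<M}" "\<lambda>m. a (n + m)" "\<lambda>_. 1"] a1 by simp
    have step: "a n = c n * (T (Suc n) - T n)" if "n \<ge> n0" for n
    proof -
      have "T (Suc n) - T n = (\<Sum>m<M. a (n + Suc m) - a (n + m))"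
        by (simp add: T_def sum_subtractf)
      also have "\<dots> = a (n + M) - a n"
        using sum_lessThan_telescope[of "\<lambda>m. a (n + m)" M] by simp
      also have "\<dots> = a n * (cis (2 * pi * \<delta> n) - 1)"
        using n1[of n] that \<open>n0 \<ge> n1\<close> by (simp add: algebra_simps)
      finally show ?thesis
        using n1[of n] that \<open>n0 \<ge> n1\<close> by (simp add: c_def)
    qed
    have tail: "norm (\<Sum>i=n0..<n. a i) \<le> (e / 2) * sqrt (real n)" if "n \<ge> n0" for n
    proof -
      have cdiff: "c m - c i = Complex 0 (Im (c m) - Im (c i))" if "i \<ge> n0" "m \<ge> n0" for i m
        using t01[of i] t01[of m] that \<open>n0 \<ge> n1\<close> by (simp add: c_cot complex_eq_iff)
      have "(\<Sum>i=n0..<n. norm (c (Suc i) - c i)) = (\<Sum>i=n0..<n. \<bar>Im (c (Suc i)) - Im (c i)\<bar>)"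
        by (intro sum.cong) (auto simp: cdiff cmod_def)
      also have "\<dots> = \<bar>Im (c n) - Im (c n0)\<bar>"
        using that n0 by (intro sum_abs_diff_monotone) auto
      also have "\<dots> \<le> norm (c n) + norm (c n0)"
        using abs_Im_le_cmod[of "c n"] abs_Im_le_cmod[of "c n0"] by linarith
      finally have var: "(\<Sum>i=n0..<n. norm (c (Suc i) - c i)) \<le> norm (c n) + norm (c n0)" .
      have cn: "norm (c n) \<le> e' * sqrt (real n)" using n1 that \<open>n0 \<ge> n1\<close> by auto
      have "norm (c n0) \<le> e' * sqrt (real n0)" using n1 \<open>n0 \<ge> n1\<close> by auto
      also have "\<dots> \<le> e' * sqrt (real n)" using that \<open>e' > 0\<close> by auto
      finally have cn0: "norm (c n0) \<le> e' * sqrt (real n)" .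
      have "(\<Sum>i=n0..<n. a i) = (\<Sum>i=n0..<n. c i * (T (Suc i) - T i))"
        by (intro sum.cong) (auto simp: step[symmetric])
      then have "norm (\<Sum>i=n0..<n. a i) \<le>
          M * (norm (c n0) + norm (c n) + (\<Sum>i=n0..<n. norm (c (Suc i) - c i)))"
        using summation_by_parts_bound[OF that, of T "real M" c] T by simp
      also have "\<dots> \<le> (M + 1) * (4 * (e' * sqrt (real n)))"
        using var cn cn0 by (intro mult_mono) (auto intro!: add_nonneg_nonneg sum_nonneg)
      also have "\<dots> = (e / 2) * sqrt (real n)"
        by (simp add: e'_def field_simps)
      finally show ?thesis .
    qed
    have "filterlim (\<lambda>n. sqrt (real n)) at_top sequentially"
      by (intro filterlim_compose[OF sqrt_at_top] filterlim_real_sequentially)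
    \<comment> \<open>Beyond this threshold the first \<open>n0\<close> terms contribute less than
      the other half, \<open>(e / 2) * sqrt n\<close>.\<close>
    then have "eventually (\<lambda>n. 2 * real n0 / e + 1 \<le> sqrt (real n)) sequentially"
      by (simp add: filterlim_at_top)
    then show "eventually (\<lambda>n. dist ((\<Sum>i<n. a i) / of_real (sqrt (real n))) 0 < e) sequentially"
      using eventually_ge_at_top[of n0] eventually_gt_at_top[of 0]
    proof eventually_elim
      case (elim n)
      have "(\<Sum>i<n. a i) = (\<Sum>i<n0. a i) + (\<Sum>i=n0..<n. a i)"
        using elim(2) by (metis lessThan_atLeast0 le0 sum.atLeastLessThan_concat)
      moreover have "norm (\<Sum>i<n0. a i) \<le> real n0"
        using sum_norm_le[of "{..<n0}" a "\<lambda>_. 1"] a1 by simp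
      ultimately have "norm (\<Sum>i<n. a i) \<le> real n0 + (e / 2) * sqrt (real n)"
        using tail[OF elim(2)] norm_triangle_ineq[of "\<Sum>i<n0. a i" "\<Sum>i=n0..<n. a i"] by simp
      also have "\<dots> < e * sqrt (real n)"
      proof -
        have "2 * real n0 / e < sqrt (real n)" using elim(1) by linarith
        then show ?thesis using \<open>e > 0\<close> by (simp add: field_simps)
      qed
      finally show ?case using elim(3) by (simp add: norm_divide field_simps)
    qed
  qed
qed

section \<open>The weights of \<open>exp (sqrt x)\<close>\<close>

text \<open>This is the derivative of \<open>exp (sqrt x)\<close>. In the variable
  \<open>s = sqrt x\<close> it is \<open>exp s / (2 * s)\<close>, which increases for
  \<open>s \<ge> 1\<close> because
  \<open>t \<le> s * (1 + (t - s)) \<le> s * exp (t - s)\<close>.\<close>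

lemma exp_sqrt_deriv_mono:
  fixes x y :: real
  assumes "1 \<le> x" "x \<le> y"
  shows "exp (sqrt x) / (2 * sqrt x) \<le> exp (sqrt y) / (2 * sqrt y)"
proof -
  define s t where "s = sqrt x" and "t = sqrt y"
  have st: "1 \<le> s" "s \<le> t" using assms by (auto simp: s_def t_def)
  have "t - s \<le> s * (t - s)" using st by (simp add: mult_le_cancel_right1)
  then have "t \<le> s * (1 + (t - s))" by (simp add: algebra_simps)
  also have "\<dots> \<le> s * exp (t - s)" using st by (intro mult_left_mono exp_ge_add_one_self) auto
  finally have "exp s * t \<le> exp s * (s * exp (t - s))" by simp
  also have "\<dots> = s * exp t" by (simp add: exp_diff)
  finally show ?thesis using st by (simp add: s_def[symmetric] t_def[symmetric] field_simps)
qed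

lemma weight_diff_exp_sqrt:
  fixes n :: nat
  assumes "n \<ge> 2"
  obtains z where "real n - 1 < z" "z < real n"
    "weight_diff (\<lambda>n. exp (sqrt (real n))) n = exp (sqrt z) / (2 * sqrt z)"
proof -
  have "\<exists>z>real (n - 1). z < real n \<and>
      exp (sqrt (real n)) - exp (sqrt (real (n - 1))) =
        (real n - real (n - 1)) * (exp (sqrt z) / (2 * sqrt z))"
    by (rule MVT2) (use assms in \<open>auto intro!: derivative_eq_intros simp: field_simps\<close>)
  then show ?thesis using assms that by (auto simp: weight_diff_def of_nat_diff)
qed

text \<open>The mean value points of two consecutive weights are separated by \<open>n\<close> and
  lie above 1, so monotonicity of the derivative carries over.\<close>

lemma weight_diff_exp_sqrt_mono:
  assumes "n \<ge> 2"
  shows "weight_diff (\<lambda>n. exp (sqrt (real n))) n \<le> weight_diff (\<lambda>n. exp (sqrt (real n))) (Suc n)"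
proof -
  obtain y where y: "real n - 1 < y" "y < real n"
    "weight_diff (\<lambda>n. exp (sqrt (real n))) n = exp (sqrt y) / (2 * sqrt y)"
    using weight_diff_exp_sqrt[OF assms] .
  obtain z where z: "real (Suc n) - 1 < z" "z < real (Suc n)"
    "weight_diff (\<lambda>n. exp (sqrt (real n))) (Suc n) = exp (sqrt z) / (2 * sqrt z)"
    using weight_diff_exp_sqrt[of "Suc n"] assms by auto
  show ?thesis
    unfolding y(3) z(3) using y(1,2) z(1,2) assms by (intro exp_sqrt_deriv_mono) auto
qed

text \<open>The mean value theorem gives a bound by half of \<open>exp (sqrt (N + 1))\<close>;
  passing back to \<open>N\<close>, the index of the normalising factor, costs a factor
  \<open>exp 1 \<le> 3\<close> since \<open>sqrt (N + 1) \<le> sqrt N + 1\<close>.\<close>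

lemma weight_diff_exp_sqrt_le:
  assumes "N \<ge> 1"
  shows "weight_diff (\<lambda>n. exp (sqrt (real n))) (Suc N) * sqrt (real (Suc N))
    \<le> 3 / 2 * exp (sqrt (real N))"
proof -
  obtain z where z: "real (Suc N) - 1 < z" "z < real (Suc N)"
    "weight_diff (\<lambda>n. exp (sqrt (real n))) (Suc N) = exp (sqrt z) / (2 * sqrt z)"
    using weight_diff_exp_sqrt[of "Suc N"] assms by auto
  have "exp (sqrt z) / (2 * sqrt z) \<le> exp (sqrt (real (Suc N))) / (2 * sqrt (real (Suc N)))"
    using z(1,2) assms by (intro exp_sqrt_deriv_mono) auto
  then have "weight_diff (\<lambda>n. exp (sqrt (real n))) (Suc N) * sqrt (real (Suc N))
      \<le> exp (sqrt (real (Suc N))) / (2 * sqrt (real (Suc N))) * sqrt (real (Suc N))"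
    unfolding z(3) by (rule mult_right_mono) simp
  also have "\<dots> = exp (sqrt (real (Suc N))) / 2" by simp
  also have "sqrt (real (Suc N)) \<le> sqrt (real N) + 1"
    by (rule real_le_lsqrt) (auto simp: power2_sum)
  then have "exp (sqrt (real (Suc N))) / 2 \<le> exp (sqrt (real N)) * exp 1 / 2"
    by (simp add: exp_add[symmetric])
  also have "\<dots> \<le> exp (sqrt (real N)) * 3 / 2"
    using exp_le by (intro divide_right_mono mult_left_mono) auto
  finally show ?thesis by simp
qed

text \<open>For weights increasing from index 2 on, the endpoint terms and the variation in Abel
  summation add up to \<open>2 * w (N + 1)\<close>. This is at most
  \<open>3 * W N / sqrt (N + 1)\<close>, which cancels the \<open>o(sqrt N)\<close> of the partial
  sums.\<close>

lemma weighted_average_exp_sqrt_tendsto_0: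
  fixes a :: "nat \<Rightarrow> complex"
  assumes a1: "\<And>n. norm (a n) \<le> 1"
    and lim: "(\<lambda>n. (\<Sum>i<n. a i) / of_real (sqrt (real n))) \<longlonglongrightarrow> 0"
  shows "(\<lambda>N. weighted_average (\<lambda>n. exp (sqrt (real n))) N a) \<longlonglongrightarrow> 0"
proof (rule tendstoI)
  fix e :: real assume "e > 0"
  define W :: "nat \<Rightarrow> real" where "W = (\<lambda>n. exp (sqrt (real n)))"
  define w where "w = weight_diff W"
  \<comment> \<open>The index 0 is included here but not in the average; only the differences
    \<open>T (Suc n) - T n = a n\<close> enter.\<close>
  define T where "T n = (\<Sum>i<n. a i)" for n
  have w_mono: "w n \<le> w (Suc n)" if "n \<ge> 2" for n
    using weight_diff_exp_sqrt_mono[OF that] by (simp add: w_def W_def)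
  have "w 2 \<ge> 0" by (simp add: w_def weight_diff_def W_def)
  have Tn: "norm (T n) \<le> real n" for n
    unfolding T_def using sum_norm_le[of "{..<n}" a "\<lambda>_. 1"] a1 by simp
  \<comment> \<open>The factor 3 from the weight estimate will turn \<open>e / 6\<close> into
    \<open>e / 2\<close>.\<close>
  have "e / 6 > 0" using \<open>e > 0\<close> by simp
  from tendstoD[OF lim this] eventually_gt_at_top[of 0]
  have "eventually (\<lambda>n. norm (T n) \<le> e / 6 * sqrt (real n)) sequentially"
    by eventually_elim (simp add: T_def[symmetric] norm_divide field_simps)
  then obtain n0 where n0: "\<And>n. n \<ge> n0 \<Longrightarrow> norm (T n) \<le> e / 6 * sqrt (real n)"
    by (auto simp: eventually_sequentially)
  \<comment> \<open>Abel summation needs one bound for all partial sums up to a given length; the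
    constant \<open>n0\<close> absorbs those where the \<open>o(sqrt n)\<close> estimate has not yet
    set in.\<close>
  have T: "norm (T n) \<le> e / 6 * sqrt (real m) + real n0" if "n \<le> m" for n m
  proof (cases "n \<ge> n0")
    case True
    have "norm (T n) \<le> e / 6 * sqrt (real n)" using n0[OF True] .
    also have "\<dots> \<le> e / 6 * sqrt (real m)" using that \<open>e > 0\<close> by auto
    finally show ?thesis by simp
  next
    case False
    then have "norm (T n) \<le> real n0" using Tn[of n] by simp
    moreover have "0 \<le> e / 6 * sqrt (real m)" using \<open>e > 0\<close> by simp
    ultimately show ?thesis by linarith
  qed
  have bound: "norm (weighted_average W N a) \<le>
      exp 1 / W N + (e / 2 + 3 * real n0 / sqrt (real (Suc N)))" if "N \<ge> 1" for N
  proof -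
    define B where "B = e / 6 * sqrt (real (Suc N)) + real n0"
    have "B \<ge> 0" using \<open>e > 0\<close> by (simp add: B_def)
    have "W N > 0" by (simp add: W_def)
    have w2: "w 2 \<le> w (Suc N)"
    proof -
      have "w 2 \<le> w n" if "2 \<le> n" for n
        using that by (induction n rule: dec_induct) (use w_mono in \<open>auto intro: order_trans\<close>)
      then show ?thesis using that by simp
    qed
    have "norm (\<Sum>n=2..<Suc N. of_real (w n) * a n) =
        norm (\<Sum>n=2..<Suc N. of_real (w n) * (T (Suc n) - T n))"
      by (simp add: T_def)
    also have "\<dots> \<le> B * (norm (complex_of_real (w 2)) + norm (complex_of_real (w (Suc N))) +
        (\<Sum>n=2..<Suc N. norm (complex_of_real (w (Suc n)) - of_real (w n))))"
      by (rule summation_by_parts_bound) (use that T[of _ "Suc N"] in \<open>auto simp: B_def\<close>)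
    also have "(\<Sum>n=2..<Suc N. norm (complex_of_real (w (Suc n)) - of_real (w n))) =
        (\<Sum>n=2..<Suc N. \<bar>w (Suc n) - w n\<bar>)"
      by (simp only: of_real_diff[symmetric] norm_of_real)
    also have "\<dots> = \<bar>w (Suc N) - w 2\<bar>"
      by (rule sum_abs_diff_monotone) (use that w_mono in auto)
    also have "norm (complex_of_real (w 2)) + norm (complex_of_real (w (Suc N))) + \<bar>w (Suc N) - w 2\<bar>
        = 2 * w (Suc N)"
      using w2 \<open>w 2 \<ge> 0\<close> by simp
    finally have *: "norm (\<Sum>n=2..<Suc N. of_real (w n) * a n) \<le> B * (2 * w (Suc N))" .
    have "w (Suc N) * sqrt (real (Suc N)) \<le> 3 / 2 * W N"
      using weight_diff_exp_sqrt_le[OF that] by (simp add: w_def W_def)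
    then have "2 * w (Suc N) \<le> 3 * W N / sqrt (real (Suc N))"
      by (simp add: pos_le_divide_eq)
    then have "B * (2 * w (Suc N)) \<le> B * (3 * W N / sqrt (real (Suc N)))"
      using \<open>B \<ge> 0\<close> by (rule mult_left_mono)
    with * have **: "norm (\<Sum>n=2..<Suc N. of_real (w n) * a n) \<le> B * (3 * W N / sqrt (real (Suc N)))"
      by simp
    \<comment> \<open>The first weight is \<open>W 1 = exp 1\<close>, which exceeds
      \<open>w 2\<close> and breaks the monotonicity, so its term is estimated separately.\<close>
    have "{1..N} = insert 1 {2..<Suc N}" using that by auto
    then have "(\<Sum>n=1..N. of_real (w n) * a n) =
        of_real (exp 1) * a 1 + (\<Sum>n=2..<Suc N. of_real (w n) * a n)"
      by (simp add: w_def weight_diff_def W_def)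
    moreover have "norm (of_real (exp 1) * a 1) \<le> exp 1"
      using a1[of 1] by (simp add: norm_mult)
    ultimately have "norm (\<Sum>n=1..N. of_real (w n) * a n) \<le>
        exp 1 + norm (\<Sum>n=2..<Suc N. of_real (w n) * a n)"
      using norm_triangle_ineq[of "of_real (exp 1) * a 1" "\<Sum>n=2..<Suc N. of_real (w n) * a n"]
      by (simp only:)
    with ** have "norm (\<Sum>n=1..N. of_real (w n) * a n) \<le>
        exp 1 + B * (3 * W N / sqrt (real (Suc N)))"
      by linarith
    then have "norm (weighted_average W N a) \<le>
        (exp 1 + B * (3 * W N / sqrt (real (Suc N)))) / W N"
      using \<open>W N > 0\<close>
      by (simp add: weighted_average_def w_def[symmetric] norm_mult norm_divide divide_right_mono)
    also have "\<dots> = exp 1 / W N + B * 3 / sqrt (real (Suc N))"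
      using \<open>W N > 0\<close> by (simp add: add_divide_distrib)
    also have "B * 3 / sqrt (real (Suc N)) = e / 2 + 3 * real n0 / sqrt (real (Suc N))"
      by (simp add: B_def field_simps del: of_nat_Suc)
    finally show ?thesis by simp
  qed
  have sq: "filterlim (\<lambda>n. sqrt (real n)) at_top sequentially"
    by (intro filterlim_compose[OF sqrt_at_top] filterlim_real_sequentially)
  have "(\<lambda>N. exp 1 / W N) \<longlonglongrightarrow> 0"
    unfolding W_def
    by (intro real_tendsto_divide_at_top[OF tendsto_const] filterlim_compose[OF exp_at_top sq])
  moreover have "(\<lambda>N. 3 * real n0 / sqrt (real (Suc N))) \<longlonglongrightarrow> 0"
    by (intro real_tendsto_divide_at_top[OF tendsto_const] filterlim_compose[OF sq filterlim_Suc])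
  ultimately have "(\<lambda>N. exp 1 / W N + (e / 2 + 3 * real n0 / sqrt (real (Suc N)))) \<longlonglongrightarrow>
      0 + (e / 2 + 0)"
    by (intro tendsto_intros)
  then have "eventually (\<lambda>N. exp 1 / W N + (e / 2 + 3 * real n0 / sqrt (real (Suc N))) < e) sequentially"
    by (rule order_tendstoD(2)) (use \<open>e > 0\<close> in simp)
  then show "eventually (\<lambda>N. dist (weighted_average (\<lambda>n. exp (sqrt (real n))) N a) 0 < e) sequentially"
    using eventually_ge_at_top[of 1]
    by eventually_elim (use bound in \<open>force simp: W_def\<close>)
qed

section \<open>Eventual signs and monotonicity in Hardy fields\<close>

lemma mono_on_of_deriv_nonneg:
  fixes f f' :: "real \<Rightarrow> real"
  assumes "eventually (\<lambda>x. (f has_real_derivative f' x) (at x)) at_top"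
    and "eventually (\<lambda>x. 0 \<le> f' x) at_top"
  shows "\<exists>a. mono_on {a..} f"
proof -
  obtain a where a: "\<And>x. x \<ge> a \<Longrightarrow> (f has_real_derivative f' x) (at x) \<and> 0 \<le> f' x"
    using eventually_conj[OF assms] by (auto simp: eventually_at_top_linorder)
  have "f x \<le> f y" if "a \<le> x" "x \<le> y" for x y
    by (rule DERIV_nonneg_imp_nondecreasing[OF that(2)]) (meson a order_trans that(1))
  then show ?thesis by (auto simp: mono_on_def intro!: exI[of _ a])
qed

text \<open>The inequalities are weak so that the property covers the zero germ and passes from a
  derivative to every primitive.\<close>

definition eventually_one_sign :: "(real \<Rightarrow> real) \<Rightarrow> bool" where
  "eventually_one_sign f \<longleftrightarrow>
     eventually (\<lambda>x. 0 \<le> f x) at_top \<or> eventually (\<lambda>x. f x \<le> 0) at_top"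

lemma eventually_monotone_of_deriv:
  fixes f f' :: "real \<Rightarrow> real"
  assumes d: "eventually (\<lambda>x. (f has_real_derivative f' x) (at x)) at_top"
    and "eventually_one_sign f'"
  shows "\<exists>a. mono_on {a..} f \<or> mono_on {a..} (\<lambda>x. - f x)"
  using assms(2) unfolding eventually_one_sign_def
proof
  assume "eventually (\<lambda>x. 0 \<le> f' x) at_top"
  with mono_on_of_deriv_nonneg[OF d] show ?thesis by blast
next
  assume "eventually (\<lambda>x. f' x \<le> 0) at_top"
  then have nonneg: "eventually (\<lambda>x. 0 \<le> - f' x) at_top" by simp
  have "eventually (\<lambda>x. ((\<lambda>x. - f x) has_real_derivative - f' x) (at x)) at_top"
    using d by eventually_elim (rule DERIV_minus)
  from mono_on_of_deriv_nonneg[OF this nonneg] show ?thesis by blast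
qed

lemma mono_on_eventually_one_sign:
  fixes f :: "real \<Rightarrow> real"
  assumes "mono_on {a..} f"
  shows "eventually_one_sign f"
proof (cases "\<exists>x\<ge>a. 0 \<le> f x")
  case True
  then obtain x where "x \<ge> a" "0 \<le> f x" by blast
  then have "0 \<le> f y" if "y \<ge> x" for y
    using assms that by (meson atLeast_iff mono_onD order_trans)
  then show ?thesis by (auto simp: eventually_one_sign_def eventually_at_top_linorder)
next
  case False
  then have "\<forall>x\<ge>a. f x \<le> 0" by force
  then show ?thesis by (auto simp: eventually_one_sign_def eventually_at_top_linorder)
qed

lemma eventually_one_sign_uminus:
  "eventually_one_sign (\<lambda>x. - f x) \<longleftrightarrow> eventually_one_sign f"
  by (auto simp: eventually_one_sign_def)

lemma eventually_one_sign_of_deriv: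
  assumes "eventually (\<lambda>x. (f has_real_derivative f' x) (at x)) at_top"
    and "eventually_one_sign f'"
  shows "eventually_one_sign f"
  using eventually_monotone_of_deriv[OF assms] mono_on_eventually_one_sign
    eventually_one_sign_uminus by blast

text \<open>A nonzero germ has an inverse in the field, hence eventually no zeros; being continuous
  there, it keeps its sign by the intermediate value theorem.\<close>

lemma hardy_field_eventually_one_sign:
  assumes "hardy_field H" and "f \<in> H"
  shows "eventually_one_sign f"
proof (cases "eventually (\<lambda>x. f x = 0) at_top")
  case True
  then have "eventually (\<lambda>x. 0 \<le> f x) at_top" by eventually_elim simp
  then show ?thesis by (simp add: eventually_one_sign_def)
next
  case False
  then obtain g where "eventually (\<lambda>x. f x * g x = 1) at_top"
    using hardy_field.inverse_closed[OF assms] by blast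
  then have "eventually (\<lambda>x. f x \<noteq> 0) at_top" by eventually_elim auto
  with hardy_field.differentiable[OF assms]
  have "eventually (\<lambda>x. f differentiable (at x) \<and> f x \<noteq> 0) at_top"
    by (rule eventually_conj)
  then obtain a where a: "\<And>x. x \<ge> a \<Longrightarrow> f differentiable (at x) \<and> f x \<noteq> 0"
    unfolding eventually_at_top_linorder by blast
  have cont: "continuous_on {a..b} f" for b
    using a by (intro continuous_at_imp_continuous_on) (auto intro: differentiable_imp_continuous_within)
  show ?thesis
  proof (cases "f a > 0")
    case True
    have "0 \<le> f x" if "x \<ge> a" for x
    proof (rule ccontr)
      assume "\<not> ?thesis"
      with IVT2'[of f x 0 a, OF _ _ that cont] True obtain y where "y \<ge> a" "f y = 0" by auto
      with a show False by blast
    qed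
    then show ?thesis by (auto simp: eventually_one_sign_def eventually_at_top_linorder)
  next
    case False
    have "f x \<le> 0" if "x \<ge> a" for x
    proof (rule ccontr)
      assume "\<not> ?thesis"
      with IVT'[of f a 0 x, OF _ _ that cont] False obtain y where "y \<ge> a" "f y = 0" by auto
      with a show False by blast
    qed
    then show ?thesis by (auto simp: eventually_one_sign_def eventually_at_top_linorder)
  qed
qed

lemma hardy_field_has_deriv:
  assumes "hardy_field H" and "f \<in> H"
  shows "eventually (\<lambda>x. (f has_real_derivative deriv f x) (at x)) at_top"
  using hardy_field.differentiable[OF assms]
  by eventually_elim (simp add: DERIV_deriv_iff_real_differentiable)

lemma hardy_field_minus_poly_has_deriv:
  assumes "hardy_field H" and "f \<in> H"
  shows "eventually (\<lambda>x. ((\<lambda>x. f x - poly q x) has_real_derivative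
    deriv f x - poly (pderiv q) x) (at x)) at_top"
  using hardy_field_has_deriv[OF assms]
  by eventually_elim (auto intro!: derivative_intros)

text \<open>
  The identity function need not belong to \<open>H\<close>, so \<open>f - q\<close> need not either; but differentiating
  often enough removes the polynomial, and one-signedness lifts from a derivative to a primitive.
\<close>

lemma hardy_field_minus_poly_eventually_one_sign:
  assumes H: "hardy_field H" and "f \<in> H"
  shows "eventually_one_sign (\<lambda>x. f x - poly q x)"
proof -
  \<comment> \<open>Generalising over \<open>f\<close> and \<open>q\<close> lets the induction pass
    to \<open>deriv f\<close> and \<open>pderiv q\<close>. The disjunct \<open>q = 0\<close>
    provides the base case, as the zero polynomial has degree 0 and not less.\<close>
  have "eventually_one_sign (\<lambda>x. f x - poly q x)" if "f \<in> H" "q = 0 \<or> degree q < n" for n f q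
    using that
  proof (induction n arbitrary: f q)
    case 0
    then show ?case using hardy_field_eventually_one_sign[OF H] by auto
  next
    case (Suc n)
    have "pderiv q = 0 \<or> degree (pderiv q) < n"
      using Suc.prems(2) by (auto simp: degree_pderiv pderiv_eq_0_iff)
    then have "eventually_one_sign (\<lambda>x. deriv f x - poly (pderiv q) x)"
      using Suc hardy_field.deriv_closed[OF H] by blast
    then show ?case
      by (rule eventually_one_sign_of_deriv[OF hardy_field_minus_poly_has_deriv[OF H Suc.prems(1)]])
  qed
  from this[of f q "Suc (degree q)"] \<open>f \<in> H\<close> show ?thesis by simp
qed

section \<open>Rational polynomials: primitives and periodicity modulo 1\<close>

lemma rpoly_add: "rpoly (p + q) x = rpoly p x + rpoly q x"
proof -
  have "map_poly of_rat (p + q) = (map_poly of_rat p + map_poly of_rat q :: real poly)"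
    by (intro poly_eqI) (simp add: coeff_map_poly of_rat_add)
  then show ?thesis by simp
qed

lemma pderiv_map_poly_of_rat:
  "pderiv (map_poly of_rat p :: real poly) = map_poly of_rat (pderiv p)"
  by (intro poly_eqI) (simp add: coeff_pderiv coeff_map_poly of_rat_mult of_rat_add)

lemma exists_pderiv_eq:
  fixes q :: "'a::field_char_0 poly"
  shows "\<exists>Q. pderiv Q = q"
proof
  have pderiv_sum: "pderiv (sum f A) = (\<Sum>i\<in>A. pderiv (f i))" for f :: "nat \<Rightarrow> 'a poly" and A
    by (induction A rule: infinite_finite_induct) (auto simp: pderiv_add)
  have "pderiv (monom (coeff q i / of_nat (Suc i)) (Suc i)) = monom (coeff q i) i" for i
    by (simp add: pderiv_monom del: of_nat_Suc)
  then have "pderiv (\<Sum>i\<le>degree q. monom (coeff q i / of_nat (Suc i)) (Suc i)) =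
      (\<Sum>i\<le>degree q. monom (coeff q i) i)"
    unfolding pderiv_sum by (intro sum.cong refl)
  then show "pderiv (\<Sum>i\<le>degree q. monom (coeff q i / of_nat (Suc i)) (Suc i)) = q"
    by (simp add: poly_as_sum_of_monoms)
qed

lemma rpoly_periodic_mod_1:
  "\<exists>M>0. \<forall>n. rpoly Q (real (n + M)) - rpoly Q (real n) \<in> \<int>"
proof -
  \<comment> \<open>The claim is strengthened for induction along Horner's scheme: shifting
    \<open>x * Q x\<close> by \<open>E\<close> produces the extra term \<open>E * Q (n + E)\<close>,
    which must be an integer too. All multiples of \<open>D\<close> are allowed because each new
    coefficient enlarges the period by its denominator.\<close>
  have "\<exists>D>0. \<forall>E. D dvd E \<longrightarrow> (\<forall>n. real E * rpoly Q (real n) \<in> \<int> \<and>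
      rpoly Q (real (n + E)) - rpoly Q (real n) \<in> \<int>)"
  proof (induction Q)
    case 0
    show ?case by (intro exI[of _ 1]) simp
  next
    case (pCons a Q)
    from pCons.IH obtain D where "D > 0" and "\<forall>E. D dvd E \<longrightarrow> (\<forall>n. real E * rpoly Q (real n) \<in> \<int> \<and>
      rpoly Q (real (n + E)) - rpoly Q (real n) \<in> \<int>)" by (elim exE conjE)
    then have D: "D > 0" "\<And>E n. D dvd E \<Longrightarrow> real E * rpoly Q (real n) \<in> \<int>"
      "\<And>E n. D dvd E \<Longrightarrow> rpoly Q (real (n + E)) - rpoly Q (real n) \<in> \<int>" by simp_all
    obtain u v where uv: "quotient_of a = (u, v)" by fastforce
    then have "v > 0" using quotient_of_denom_pos by blast
    have a: "a = of_int u / of_int v" using quotient_of_div[OF uv] .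
    have eval: "rpoly (pCons a Q) x = of_rat a + x * rpoly Q x" for x
      by (simp add: map_poly_pCons)
    show ?case
    proof (intro exI[of _ "D * nat v"] conjI allI impI)
      show "D * nat v > 0" using \<open>D > 0\<close> \<open>v > 0\<close> by simp
      fix E n assume E: "D * nat v dvd E"
      then have dE: "D dvd E" by (metis dvd_mult_left)
      from E obtain m where m: "E = D * nat v * m" ..
      have "real E * real_of_rat a = real D * of_int u * real m"
        using \<open>v > 0\<close> by (simp add: m a of_rat_divide)
      then have "real E * real_of_rat a \<in> \<int>" by simp
      moreover have "real E * rpoly Q (real n) * real n \<in> \<int>"
        by (rule Ints_mult[OF D(2)[OF dE] Ints_of_nat])
      ultimately have "real E * of_rat a + real E * rpoly Q (real n) * real n \<in> \<int>"
        by (rule Ints_add)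
      moreover have "real E * rpoly (pCons a Q) (real n) =
          real E * of_rat a + real E * rpoly Q (real n) * real n"
        unfolding eval by (simp only: ring_distribs mult_ac)
      ultimately show "real E * rpoly (pCons a Q) (real n) \<in> \<int>" by (simp only:)
      have "rpoly (pCons a Q) (real (n + E)) - rpoly (pCons a Q) (real n) =
          real n * (rpoly Q (real (n + E)) - rpoly Q (real n)) + real E * rpoly Q (real (n + E))"
        unfolding eval by (simp add: ring_distribs)
      moreover have "real n * (rpoly Q (real (n + E)) - rpoly Q (real n)) +
          real E * rpoly Q (real (n + E)) \<in> \<int>"
        by (rule Ints_add[OF Ints_mult[OF Ints_of_nat D(3)[OF dE]] D(2)[OF dE]])
      ultimately show "rpoly (pCons a Q) (real (n + E)) - rpoly (pCons a Q) (real n) \<in> \<int>"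
        by (simp only:)
    qed
  qed
  then show ?thesis by (meson dvd_refl)
qed

section \<open>Increments over \<open>M\<close> steps and their distance from the integers\<close>

lemma increment_mean_value:
  fixes g u :: "real \<Rightarrow> real"
  assumes "eventually (\<lambda>x. (g has_real_derivative u x) (at x)) at_top" and "M > 0"
  shows "\<exists>\<xi>. eventually (\<lambda>n. real n < \<xi> n \<and> \<xi> n < real (n + M) \<and>
    g (real (n + M)) - g (real n) = real M * u (\<xi> n)) sequentially"
proof -
  obtain b where b: "\<And>x. x \<ge> b \<Longrightarrow> (g has_real_derivative u x) (at x)"
    using assms(1) by (auto simp: eventually_at_top_linorder)
  have "\<exists>z. real n < z \<and> z < real (n + M) \<and> g (real (n + M)) - g (real n) = real M * u z"
    if "n \<ge> nat \<lceil>b\<rceil>" for n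
  proof -
    have "b \<le> real n" using that by linarith
    then have "\<exists>z>real n. z < real (n + M) \<and>
        g (real (n + M)) - g (real n) = (real (n + M) - real n) * u z"
      using \<open>M > 0\<close> by (intro MVT2 b) auto
    then show ?thesis by auto
  qed
  then obtain \<xi> where "\<And>n. n \<ge> nat \<lceil>b\<rceil> \<Longrightarrow> real n < \<xi> n \<and> \<xi> n < real (n + M) \<and>
      g (real (n + M)) - g (real n) = real M * u (\<xi> n)"
    by metis
  then show ?thesis unfolding eventually_sequentially by blast
qed

text \<open>The mean value points of two successive \<open>M\<close>-step increments lie in
  intervals that may overlap. Rearranged, the inequality compares the one-step increments at
  \<open>n\<close> and at \<open>n + M\<close>, whose mean value points are ordered as soon as
  \<open>M \<ge> 1\<close>.\<close>

lemma increment_mono: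
  fixes g u :: "real \<Rightarrow> real"
  assumes "eventually (\<lambda>x. (g has_real_derivative u x) (at x)) at_top" and u: "mono_on {a..} u"
  shows "eventually (\<lambda>n. g (real (n + M)) - g (real n) \<le>
    g (real (Suc n + M)) - g (real (Suc n))) sequentially"
proof (cases "M = 0")
  case False
  obtain \<xi> where \<xi>: "eventually (\<lambda>n. real n < \<xi> n \<and> \<xi> n < real (n + 1) \<and>
      g (real (n + 1)) - g (real n) = real 1 * u (\<xi> n)) sequentially"
    using increment_mean_value[OF assms(1), of 1] by auto
  have "eventually (\<lambda>n. real (n + M) < \<xi> (n + M) \<and>
      g (real (n + M + 1)) - g (real (n + M)) = u (\<xi> (n + M))) sequentially"
    using \<xi>[THEN eventually_sequentially_seg[THEN iffD2, of _ M]] by eventually_elim simp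
  with \<xi> eventually_ge_at_top[of "nat \<lceil>a\<rceil>"] show ?thesis
  proof eventually_elim
    case (elim n)
    have "a \<le> real n" using elim(2) by linarith
    then have "a \<le> \<xi> n" using elim(1) by linarith
    moreover have "\<xi> n \<le> \<xi> (n + M)" using elim(1,3) False by (simp; linarith)
    ultimately have "u (\<xi> n) \<le> u (\<xi> (n + M))"
      using u by (auto intro: mono_onD)
    then show ?case using elim(1,3) by (simp add: add_ac)
  qed
qed simp

text \<open>The norm is \<open>2 * \<bar>sin (pi * \<delta> n)\<bar>\<close>. If \<open>l\<close> is
  not an integer it tends to a positive limit and \<open>sqrt n\<close> alone diverges; if
  \<open>l = j\<close>, it is asymptotic to \<open>2 * pi * \<bar>\<delta> n - j\<bar>\<close> and
  the hypothesis \<open>int\<close> applies.\<close>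

lemma sqrt_mult_cis_minus_one_at_top:
  fixes \<delta> :: "nat \<Rightarrow> real"
  assumes lim: "\<delta> \<longlonglongrightarrow> l"
    and int: "\<And>j::int. l = of_int j \<Longrightarrow>
      filterlim (\<lambda>n. sqrt (real n) * \<bar>\<delta> n - of_int j\<bar>) at_top sequentially"
  shows "filterlim (\<lambda>n. sqrt (real n) * norm (cis (2 * pi * \<delta> n) - 1)) at_top sequentially"
proof (cases "l \<in> \<int>")
  case False
  have "cis (2 * pi * l) \<noteq> 1"
  proof
    assume "cis (2 * pi * l) = 1"
    then have "cos (2 * pi * l) = 1" by (simp add: complex_eq_iff)
    then obtain n :: int where "2 * pi * l = of_int n * 2 * pi"
      using cos_one_2pi_int by blast
    then have "l = of_int n" by simp
    with False show False by simp
  qed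
  then have "norm (cis (2 * pi * l) - 1) > 0" by simp
  moreover have "(\<lambda>n. norm (cis (2 * pi * \<delta> n) - 1)) \<longlonglongrightarrow> norm (cis (2 * pi * l) - 1)"
    unfolding cis_conv_exp by (intro tendsto_intros lim)
  moreover have "filterlim (\<lambda>n. sqrt (real n)) at_top sequentially"
    by (intro filterlim_compose[OF sqrt_at_top] filterlim_real_sequentially)
  ultimately have "filterlim (\<lambda>n. norm (cis (2 * pi * \<delta> n) - 1) * sqrt (real n)) at_top sequentially"
    by (intro filterlim_tendsto_pos_mult_at_top)
  then show ?thesis by (simp add: mult.commute)
next
  case True
  then obtain j where j: "l = of_int j" by (auto elim: Ints_cases)
  define s where "s n = \<delta> n - of_int j" for n
  have s_large: "filterlim (\<lambda>n. sqrt (real n) * \<bar>s n\<bar>) at_top sequentially"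
    using int[OF j] by (simp add: s_def)
  have s_ne: "eventually (\<lambda>n. s n \<noteq> 0) sequentially"
    using filterlim_at_top_dense[THEN iffD1, OF s_large, rule_format, of 0]
    by eventually_elim auto
  have "(\<lambda>n. pi * s n) \<longlonglongrightarrow> pi * (l - of_int j)"
    unfolding s_def by (intro tendsto_intros lim)
  \<comment> \<open>The limit of \<open>sin x / x\<close> is taken on a punctured neighbourhood of
    0, so \<open>s n \<noteq> 0\<close> is required.\<close>
  then have "filterlim (\<lambda>n. pi * s n) (at 0) sequentially"
    using s_ne j by (auto simp: filterlim_at)
  moreover have "((\<lambda>x::real. sin x / x) \<longlongrightarrow> 1) (at 0)"
    using DERIV_sin[of "0::real"] unfolding DERIV_def by simp
  ultimately have "(\<lambda>n. sin (pi * s n) / (pi * s n)) \<longlonglongrightarrow> 1"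
    by (rule filterlim_compose[rotated])
  then have "(\<lambda>n. 2 * pi * \<bar>sin (pi * s n) / (pi * s n)\<bar>) \<longlonglongrightarrow> 2 * pi * \<bar>1\<bar>"
    by (intro tendsto_intros)
  then have "filterlim (\<lambda>n. 2 * pi * \<bar>sin (pi * s n) / (pi * s n)\<bar> * (sqrt (real n) * \<bar>s n\<bar>))
      at_top sequentially"
    by (rule filterlim_tendsto_pos_mult_at_top) (use s_large in auto)
  moreover have "eventually (\<lambda>n. 2 * pi * \<bar>sin (pi * s n) / (pi * s n)\<bar> * (sqrt (real n) * \<bar>s n\<bar>) =
      sqrt (real n) * norm (cis (2 * pi * \<delta> n) - 1)) sequentially"
    using s_ne
  proof eventually_elim
    case (elim n)
    have "cis (2 * pi * \<delta> n) = cis (2 * pi * s n) * cis (2 * pi * of_int j)"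
      unfolding cis_mult by (simp add: s_def algebra_simps)
    then have "norm (cis (2 * pi * \<delta> n) - 1) = norm (cis (2 * pi * s n) - 1)" by simp
    also have "\<dots> = norm (exp (\<i> * of_real (2 * pi * s n)) - 1)" by (simp only: cis_conv_exp)
    also have "\<dots> = 2 * \<bar>sin (2 * pi * s n / 2)\<bar>" by (rule dist_exp_i_1)
    finally show ?case using elim by (simp add: abs_mult abs_divide)
  qed
  ultimately show ?thesis by (rule filterlim_cong[THEN iffD1, rotated 3, OF _ refl refl])
qed

section \<open>Exponential sums along a Hardy field function\<close>

theorem theorem5p3:
  fixes H :: "(real \<Rightarrow> real) set" and h :: "real \<Rightarrow> real"
  assumes "hardy_field H" and "h \<in> H"
    and "polynomial_growth h"
    and "\<forall>p :: rat poly. filterlim (\<lambda>x. sqrt x * \<bar>deriv h x - rpoly p x\<bar>) at_top at_top"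
    and "\<exists>q :: rat poly. \<exists>L :: real. ((\<lambda>x. \<bar>deriv h x - rpoly q x\<bar>) \<longlongrightarrow> L) at_top"
  shows "\<forall>k :: int. k \<noteq> 0 \<longrightarrow>
    (\<lambda>N. weighted_average (\<lambda>n. exp (sqrt (real n))) N
           (\<lambda>n. exp (2 * of_real pi * \<i> * of_int k * of_real (h (real n))))) \<longlonglongrightarrow> 0"
proof (intro allI impI)
  fix k :: int
  assume "k \<noteq> 0"
  note H = assms(1)
  obtain q :: "rat poly" and L :: real
    where L: "((\<lambda>x. \<bar>deriv h x - rpoly q x\<bar>) \<longlongrightarrow> L) at_top"
    using assms(5) by blast
  obtain Q where Q: "pderiv Q = q" using exists_pderiv_eq[of q] by blast
  define u where "u x = deriv h x - rpoly q x" for x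
  define g where "g x = h x - rpoly Q x" for x
  have dh: "deriv h \<in> H" using hardy_field.deriv_closed[OF H assms(2)] .
  have g_deriv: "eventually (\<lambda>x. (g has_real_derivative u x) (at x)) at_top"
    using hardy_field_minus_poly_has_deriv[OF H assms(2), of "map_poly of_rat Q"]
    by (simp add: g_def[abs_def] u_def pderiv_map_poly_of_rat Q)

  \<comment> \<open>The hypothesis controls only the absolute value of \<open>u\<close>; as
    \<open>u\<close> eventually has one sign, \<open>u\<close> itself converges.\<close>
  have "\<exists>l. (u \<longlongrightarrow> l) at_top"
    using hardy_field_minus_poly_eventually_one_sign[OF H dh, of "map_poly of_rat q"]
    unfolding eventually_one_sign_def
  proof
    assume "eventually (\<lambda>x. 0 \<le> deriv h x - rpoly q x) at_top"
    then have "eventually (\<lambda>x. \<bar>deriv h x - rpoly q x\<bar> = u x) at_top"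
      by eventually_elim (simp add: u_def)
    from Lim_transform_eventually[OF L this] show ?thesis by (rule exI)
  next
    assume "eventually (\<lambda>x. deriv h x - rpoly q x \<le> 0) at_top"
    then have "eventually (\<lambda>x. - \<bar>deriv h x - rpoly q x\<bar> = u x) at_top"
      by eventually_elim (simp add: u_def)
    from Lim_transform_eventually[OF tendsto_minus[OF L] this] show ?thesis by (rule exI)
  qed
  then obtain l where l: "(u \<longlongrightarrow> l) at_top" by blast

  have u_large: "filterlim (\<lambda>x. sqrt x * \<bar>u x - of_rat r\<bar>) at_top at_top" for r
    using assms(4)[rule_format, of "q + [:r:]"]
    by (simp add: rpoly_add u_def map_poly_pCons algebra_simps)

  \<comment> \<open>The derivative of \<open>u\<close> is the second derivative of \<open>h\<close>
    minus a polynomial, so it eventually has one sign as well.\<close>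
  have "\<exists>a. mono_on {a..} u \<or> mono_on {a..} (\<lambda>x. - u x)"
    unfolding u_def
    by (rule eventually_monotone_of_deriv[OF
        hardy_field_minus_poly_has_deriv[OF H dh]
        hardy_field_minus_poly_eventually_one_sign[OF H hardy_field.deriv_closed[OF H dh]]])
  then obtain a where u_mono: "mono_on {a..} u \<or> mono_on {a..} (\<lambda>x. - u x)" ..

  obtain M where "M > 0" and M: "\<And>n. rpoly Q (real (n + M)) - rpoly Q (real n) \<in> \<int>"
    using rpoly_periodic_mod_1[of Q] by blast
  define d where "d n = g (real (n + M)) - g (real n)" for n
  define \<delta> where "\<delta> n = of_int k * d n" for n
  define e where "e n = cis (2 * pi * (of_int k * h (real n)))" for n :: nat

  have e_rec: "e (n + M) = e n * cis (2 * pi * \<delta> n)" for n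
  proof -
    obtain m :: int where m: "rpoly Q (real (n + M)) - rpoly Q (real n) = of_int m"
      using M[of n] by (auto elim: Ints_cases)
    have "h (real (n + M)) = h (real n) + d n + of_int m"
      using m by (simp add: d_def g_def)
    then have "e (n + M) = e n * cis (2 * pi * \<delta> n) * cis (2 * pi * of_int (k * m))"
      unfolding e_def \<delta>_def cis_mult by (simp only: ring_distribs mult_ac of_int_mult)
    then show ?thesis by (simp del: of_int_mult)
  qed

  have "eventually (\<lambda>n. d n \<le> d (Suc n)) sequentially \<or>
      eventually (\<lambda>n. d (Suc n) \<le> d n) sequentially"
    using u_mono
  proof
    assume "mono_on {a..} u"
    from increment_mono[OF g_deriv this, of M] show ?thesis by (simp add: d_def)
  next
    assume *: "mono_on {a..} (\<lambda>x. - u x)"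
    have "eventually (\<lambda>x. ((\<lambda>x. - g x) has_real_derivative - u x) (at x)) at_top"
      using g_deriv by eventually_elim (rule DERIV_minus)
    from increment_mono[OF this *, of M]
    have "eventually (\<lambda>n. d (Suc n) \<le> d n) sequentially"
      by eventually_elim (simp add: d_def)
    then show ?thesis ..
  qed
  then have \<delta>_mono: "eventually (\<lambda>n. \<delta> n \<le> \<delta> (Suc n)) sequentially \<or>
      eventually (\<lambda>n. \<delta> (Suc n) \<le> \<delta> n) sequentially"
    \<comment> \<open>A negative \<open>k\<close> exchanges the two alternatives.\<close>
    using \<open>k \<noteq> 0\<close> by (cases "k > 0") (auto simp: \<delta>_def mult_le_cancel_left)

  obtain \<xi> where \<xi>: "eventually (\<lambda>n. real n < \<xi> n \<and> \<xi> n < real (n + M) \<and>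
      d n = real M * u (\<xi> n)) sequentially"
    using increment_mean_value[OF g_deriv \<open>M > 0\<close>] unfolding d_def by blast
  have \<xi>_top: "filterlim \<xi> at_top sequentially"
    by (rule filterlim_at_top_mono[OF filterlim_real_sequentially])
      (use \<xi> in eventually_elim, simp)
  have "(\<lambda>n. of_int k * (real M * u (\<xi> n))) \<longlonglongrightarrow> of_int k * (real M * l)"
    by (intro tendsto_intros filterlim_compose[OF l \<xi>_top])
  moreover have "eventually (\<lambda>n. of_int k * (real M * u (\<xi> n)) = \<delta> n) sequentially"
    using \<xi> by eventually_elim (simp add: \<delta>_def)
  ultimately have \<delta>_lim: "\<delta> \<longlonglongrightarrow> of_int k * (real M * l)"
    by (rule Lim_transform_eventually)

  have "filterlim (\<lambda>n. sqrt (real n) * norm (cis (2 * pi * \<delta> n) - 1)) at_top sequentially"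
  proof (rule sqrt_mult_cis_minus_one_at_top[OF \<delta>_lim])
    fix j :: int
    \<comment> \<open>This \<open>r\<close> is chosen so that
      \<open>\<delta> n - j = k * M * (u (\<xi> n) - r)\<close>, which reduces the claim to
      \<open>u_large\<close> at the points \<open>\<xi> n\<close>. The denominator of
      \<open>c\<close> pays for replacing \<open>sqrt (\<xi> n)\<close> by \<open>sqrt n\<close>,
      since \<open>\<xi> n < n + M \<le> n * (M + 1)\<close> for \<open>n \<ge> 1\<close>.\<close>
    define r :: rat where "r = of_int j / (of_int k * of_nat M)"
    define c where "c = \<bar>of_int k * real M\<bar> / sqrt (real (Suc M))"
    have "c > 0" using \<open>k \<noteq> 0\<close> \<open>M > 0\<close> by (simp add: c_def)
    have kMr: "of_int k * (real M * of_rat r) = of_int j"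
      using \<open>k \<noteq> 0\<close> \<open>M > 0\<close> by (simp add: r_def of_rat_divide of_rat_mult)
    have "filterlim (\<lambda>n. c * (sqrt (\<xi> n) * \<bar>u (\<xi> n) - of_rat r\<bar>)) at_top sequentially"
      by (rule filterlim_tendsto_pos_mult_at_top[OF tendsto_const \<open>c > 0\<close>])
        (rule filterlim_compose[OF u_large \<xi>_top])
    moreover have "eventually (\<lambda>n. c * (sqrt (\<xi> n) * \<bar>u (\<xi> n) - of_rat r\<bar>) \<le>
        sqrt (real n) * \<bar>\<delta> n - of_int j\<bar>) sequentially"
      using \<xi> eventually_ge_at_top[of 1]
    proof eventually_elim
      case (elim n)
      have "\<xi> n \<le> real n + real M" using elim(1) by simp
      also have "\<dots> \<le> real n + real n * real M" using elim(2) by (simp add: mult_le_cancel_right1)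
      finally have "\<xi> n \<le> real n * real (Suc M)" by (simp add: algebra_simps)
      then have "sqrt (\<xi> n) \<le> sqrt (real n) * sqrt (real (Suc M))"
        by (simp only: real_sqrt_mult[symmetric] real_sqrt_le_iff)
      then have "sqrt (\<xi> n) / sqrt (real (Suc M)) \<le> sqrt (real n)"
        by (simp add: pos_divide_le_eq del: of_nat_Suc)
      then have "sqrt (\<xi> n) / sqrt (real (Suc M)) * (\<bar>of_int k * real M\<bar> * \<bar>u (\<xi> n) - of_rat r\<bar>) \<le>
          sqrt (real n) * (\<bar>of_int k * real M\<bar> * \<bar>u (\<xi> n) - of_rat r\<bar>)"
        by (rule mult_right_mono) simp
      moreover have "\<delta> n - of_int j = of_int k * real M * (u (\<xi> n) - of_rat r)"
        using elim(1) by (simp add: \<delta>_def kMr[symmetric] algebra_simps)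
      ultimately show ?case by (simp add: c_def abs_mult mult_ac)
    qed
    ultimately show "filterlim (\<lambda>n. sqrt (real n) * \<bar>\<delta> n - of_int j\<bar>) at_top sequentially"
      by (rule filterlim_at_top_mono)
  qed
  then have "(\<lambda>n. (\<Sum>i<n. e i) / of_real (sqrt (real n))) \<longlonglongrightarrow> 0"
    by (intro sum_little_o_sqrt[OF _ _ \<delta>_mono \<delta>_lim, of e M]) (auto simp: e_rec, simp add: e_def)
  then have "(\<lambda>N. weighted_average (\<lambda>n. exp (sqrt (real n))) N e) \<longlonglongrightarrow> 0"
    by (intro weighted_average_exp_sqrt_tendsto_0) (auto simp: e_def)
  moreover have "e = (\<lambda>n. exp (2 * of_real pi * \<i> * of_int k * of_real (h (real n))))"
    by (simp add: fun_eq_iff e_def cis_conv_exp mult_ac)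
  ultimately show "(\<lambda>N. weighted_average (\<lambda>n. exp (sqrt (real n))) N
      (\<lambda>n. exp (2 * of_real pi * \<i> * of_int k * of_real (h (real n))))) \<longlonglongrightarrow> 0"
    by simp
qed

end
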